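(* Let $\lambda$ be a rather odd partition and put $D=D(\lambda)$. Then $$\rho(\lambda)=\begin{cases}\big(A,\,B\big) & \text{if } d(\lambda)>0,\\ \big(B,\,A\big) & \text{if } d(\lambda)\le 0,\end{cases}$$ where $$A=(\underline\lambda^0-\underline D^0)\cup(\lambda^1-D^1)\cup(\underline\lambda^2+1-\underline D^2),\qquad B=(\underline\lambda^0+\underline D^0)\cup(\lambda^3+D^3)\cup(\underline\lambda^2+\underline D^2).$$
   Context: Partitions are written in non-decreasing order $\lambda=(\lambda_1\le\dots\le\lambda_m)$ with positive parts. A partition is rather odd if every even part occurs with even multiplicity and every odd part occurs with multiplicity at most $1$. For $m\in\mathbb Z$ let $d(m)=0$ if $m$ is even, $d(m)=1$ if $m\equiv1\pmod4$, $d(m)=-1$ if $m\equiv3\pmod 4$; $d(\lambda)=\sum_i d(\lambda_i)$. **The bipartition $\rho(\lambda)$** (Lusztig–Spaltenstein; it describes the generalized Springer correspondence for spin groups). Defined recursively. If $m=0$, $\rho(\lambda)=((0),(0))$. If $m>0$, let $\mu=(\lambda_1\le\dots\le\lambda_{m-1})$ if $\lambda_m$ is odd and $\mu=(\lambda_1\le\dots\le\lambda_{m-2})$ if $\lambda_m$ is even; let $\rho(\mu)=(\gamma,\delta)$ and $\rho(\lambda)=(\alpha,\beta)$, where: (a) if $d(\lambda_m)=0$, put $r=\lfloor\frac14(\lambda_m+2)\rfloor-d(\mu)$, $s=\lfloor\frac14\lambda_m\rfloor+d(\mu)$. If $d(\mu)>0$: $\alpha=(\gamma,r)$, $\beta=(\delta,s)$.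 If $d(\mu)\le0$: $\alpha=(\gamma,s)$, $\beta=(\delta,r)$. (b) if $d(\lambda_m)=1$, put $r=\frac14(\lambda_m-1)-d(\mu)$. If $d(\mu)>0$: $\alpha=(\gamma,r)$, $\beta=\delta$. If $d(\mu)=0$: $\alpha=(\delta,r)$, $\beta=\gamma$. If $d(\mu)<0$: $\alpha=\gamma$, $\beta=(\delta,r)$. (c) if $d(\lambda_m)=-1$, put $r=\frac14(\lambda_m-3)+d(\mu)$. If $d(\mu)>1$: $\alpha=\gamma$, $\beta=(\delta,r)$. If $d(\mu)=1$: $\alpha=(\delta,r)$, $\beta=\gamma$. If $d(\mu)<1$: $\alpha=(\gamma,r)$, $\beta=\delta$. Here $(\gamma,r)$ means $\gamma$ with the part $r$ adjoined; zeros in partitions are ignored. **Notation in the formula.** For an integer $n$ write $n=4q(n)+r(n)$ with $r(n)\in\{0,1,2,3\}$. For $x\in\{0,1,2,3\}$, $\lambda^x=(q(\lambda_i)\mid r(\lambda_i)=x)$, and for any sequence $\mu=(\mu_1,\dots,\mu_m)$ of the same length as $\lambda$, $\mu^x=(\mu_i\mid r(\lambda_i)=x)$. $D(\lambda)$ is the sequence with $i$-th entry $\sum_{j<i}d(\lambda_j)$, and $D^x=D(\lambda)^x$. For $x\in\{0,2\}$, since even parts of $\lambda$ have even multiplicity, the entries of $\lambda^x$ and $D^x$ come in equal consecutive pairs; $\underline\lambda^x$ and $\underline D^x$ denote the sequences of half the length obtained by keeping one entry from each pair (so $\lambda^x=\underline\lambda^x\cup\underline\lambda^x$, $D^x=\underline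 D^x\cup\underline D^x$). Sums and differences of sequences of equal length are entrywise, adding $1$ means adding $1$ to each entry, and $\cup$ is multiset union. *)

theory Defs
  imports Main "HOL-Library.Multiset"
begin

definition is_partition :: "int list \<Rightarrow> bool" where
  "is_partition lam \<longleftrightarrow> sorted lam \<and> (\<forall>a \<in> set lam. a > 0)"

definition rather_odd :: "int list \<Rightarrow> bool" where
  "rather_odd lam \<longleftrightarrow>
     (\<forall>k. even k \<longrightarrow> even (count_list lam k)) \<and>
     (\<forall>k. odd k \<longrightarrow> count_list lam k \<le> 1)"

definition d :: "int \<Rightarrow> int" where
  "d m = (if even m then 0 else if m mod 4 = 1 then 1 else -1)"

definition d_total :: "int list \<Rightarrow> int" where
  "d_total lam = (\<Sum>a\<leftarrow>lam. d a)"

text \<open>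
  The members of a bipartition are multisets of nonzero integers: zero parts are
  ignored, while parts are kept as integers so that no subtraction truncates.
\<close>

definition drop_zeros :: "int multiset \<Rightarrow> int multiset" where
  "drop_zeros M = filter_mset (\<lambda>a. a \<noteq> 0) M"

definition adjoin :: "int multiset \<Rightarrow> int \<Rightarrow> int multiset" where
  "adjoin M a = drop_zeros (add_mset a M)"

text \<open>
  The largest part of a nonempty partition is its last entry. In a rather odd
  partition an even largest part occurs at least twice, so the recursion
  removes two copies of it; on other lists the values are irrelevant.
\<close>

function rho :: "int list \<Rightarrow> int multiset \<times> int multiset" where
  "rho lam =
     (if lam = [] then ({#}, {#})
      else
        let l = last lam;
            mu = (if odd l then butlast lam else butlast (butlast lam));
            e = d_total mu;
            (\<gamma>, \<delta>) = rho mu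
        in
          if d l = 0 then
            (let r = (l + 2) div 4 - e;
                 s = l div 4 + e
             in if e > 0 then (adjoin \<gamma> r, adjoin \<delta> s)
                else (adjoin \<gamma> s, adjoin \<delta> r))
          else if d l = 1 then
            (let r = (l - 1) div 4 - e
             in if e > 0 then (adjoin \<gamma> r, \<delta>)
                else if e = 0 then (adjoin \<delta> r, \<gamma>)
                else (\<gamma>, adjoin \<delta> r))
          else
            (let r = (l - 3) div 4 + e
             in if e > 1 then (\<gamma>, adjoin \<delta> r)
                else if e = 1 then (adjoin \<delta> r, \<gamma>)
                else (adjoin \<gamma> r, \<delta>)))"
  by pat_completeness auto
termination
  by (relation "measure length") auto

text \<open>The defining equation rewrites indefinitely if used by the simplifier.\<close>

declare rho.simps [simp del]

definition D_seq :: "int list \<Rightarrow> int list" where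
  "D_seq lam = map (\<lambda>i. \<Sum>j<i. d (lam ! j)) [0..<length lam]"

text \<open>
  \<open>select lam x mu\<close> is the subsequence of those \<open>mu ! i\<close> for which
  \<open>lam ! i mod 4 = x\<close>, where \<open>mu\<close> has the same length as \<open>lam\<close>.
\<close>

definition select :: "int list \<Rightarrow> int \<Rightarrow> int list \<Rightarrow> int list" where
  "select lam x mu = map snd (filter (\<lambda>(a, b). a mod 4 = x) (zip lam mu))"

definition quot_part :: "int list \<Rightarrow> int \<Rightarrow> int list" where
  "quot_part lam x = select lam x (map (\<lambda>a. a div 4) lam)"

definition D_part :: "int list \<Rightarrow> int \<Rightarrow> int list" where
  "D_part lam x = select lam x (D_seq lam)"

text \<open>
  Keeps the first entry of each consecutive pair. It is meant for sequences
  of even length that consist of equal consecutive pairs.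
\<close>

fun one_of_each_pair :: "'a list \<Rightarrow> 'a list" where
  "one_of_each_pair (a # b # xs) = a # one_of_each_pair xs"
| "one_of_each_pair xs = []"

abbreviation seq_plus :: "int list \<Rightarrow> int list \<Rightarrow> int list" (infixl "\<oplus>" 65) where
  "xs \<oplus> ys \<equiv> map2 (+) xs ys"

abbreviation seq_minus :: "int list \<Rightarrow> int list \<Rightarrow> int list" (infixl "\<ominus>" 65) where
  "xs \<ominus> ys \<equiv> map2 (-) xs ys"

abbreviation seq_inc :: "int list \<Rightarrow> int list" where
  "seq_inc xs \<equiv> map (\<lambda>a. a + 1) xs"

end

theory Submission
  imports Defs
begin

text \<open>
  Why the formula holds: for a fixed $\lambda$ every part contributes one entry to $A$ (residue 1),
  one entry to $B$ (residue 3), or, if it is even, one entry to each of $A$ and $B$ per pair of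
  equal parts; and that contribution depends on the part itself and on the value of $d$ on the
  parts before it, but on nothing that follows. So $A$ and $B$ grow by adjoining entries as
  $\lambda$ is built up by appending an odd part or a pair of equal even parts, and these are the
  steps of the recursion for $\rho$. The entries adjoined by the recursion are the right ones,
  because $\lfloor(4q+2)/4\rfloor = q$ and $\lfloor(4q+4)/4\rfloor = q+1$ account for the shift by
  one in the residue 2 term of $A$.

  The rest is bookkeeping about which component is which. The formula puts $A$ first exactly when
  $d > 0$. The sign condition changes only when $d$ goes from $0$ to $1$ (an appended part of
  residue 1) or from $1$ to $0$ (an appended part of residue 3), and in exactly these two cases the
  recursion interchanges the two components.

  Accordingly the proof is an induction along \<open>even_paired\<close>, the way of building the list from
  the left, with \<open>bipartition_odd_step\<close> and \<open>bipartition_even_step\<close> as its induction steps.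
\<close>

text \<open>
  The structure that the recursion follows: even entries are appended in equal adjacent pairs.
  For a sorted list it expresses that even parts have even multiplicity.
\<close>

inductive even_paired :: "int list \<Rightarrow> bool" where
  empty: "even_paired []"
| odd_part: "even_paired mu \<Longrightarrow> odd l \<Longrightarrow> even_paired (mu @ [l])"
| even_pair: "even_paired mu \<Longrightarrow> even l \<Longrightarrow> even_paired (mu @ [l, l])"

text \<open>
  In a sorted list an even largest part that occurs an even number of times occupies the last two
  places, and removing both copies leaves all multiplicities even.
\<close>

lemma even_paired_if_sorted:
  assumes "sorted lam" and "\<And>k. even k \<Longrightarrow> even (count_list lam k)"
  shows "even_paired lam"
  using assms
proof (induction lam rule: length_induct)
  case (1 lam)
  show ?case
  proof (cases lam rule: rev_cases)
    case Nil
    then show ?thesis by (simp add: even_paired.empty)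
  next
    case (snoc mu l)
    show ?thesis
    proof (cases "even l")
      case False
      have "even (count_list mu k)" if "even k" for k
        using "1.prems"(2)[OF that] False that snoc by (auto split: if_splits)
      then have "even_paired mu"
        using 1 snoc by (simp add: sorted_append)
      then show ?thesis using False snoc even_paired.odd_part by simp
    next
      case True
      have "odd (count_list mu l)"
        using "1.prems"(2)[OF True] snoc by simp
      then have "l \<in> set mu"
        by (metis count_notin even_zero)
      then obtain nu l' where mu: "mu = nu @ [l']"
        by (cases mu rule: rev_cases) auto
      have "l' = l"
        using \<open>l \<in> set mu\<close> "1.prems"(1) snoc mu by (force simp: sorted_append)
      then have lam: "lam = nu @ [l, l]" using snoc mu by simp
      have "even (count_list nu k)" if "even k" for k
        using "1.prems"(2)[OF that] lam by (auto split: if_splits)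
      then have "even_paired nu"
        using 1 lam by (simp add: sorted_append)
      then show ?thesis using True lam even_paired.even_pair by simp
    qed
  qed
qed

lemma d_total_Nil [simp]: "d_total [] = 0"
  and d_total_append [simp]: "d_total (xs @ ys) = d_total xs + d_total ys"
  and d_total_Cons [simp]: "d_total (x # xs) = d x + d_total xs"
  by (simp_all add: d_total_def)

lemma drop_zeros_simps [simp]:
  "drop_zeros {#} = {#}"
  "drop_zeros (M + N) = drop_zeros M + drop_zeros N"
  "adjoin (drop_zeros M) a = drop_zeros (add_mset a M)"
  by (simp_all add: drop_zeros_def adjoin_def filter_filter_mset)

lemma select_append:
  "length xs = length ys \<Longrightarrow> select (xs @ xs') x (ys @ ys') = select xs x ys @ select xs' x ys'"
  by (simp add: select_def)

lemma D_seq_snoc: "D_seq (mu @ [l]) = D_seq mu @ [d_total mu]"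
proof -
  have "(\<Sum>j<i. d ((mu @ [l]) ! j)) = (\<Sum>j<i. d (mu ! j))" if "i \<le> length mu" for i
    using that by (intro sum.cong) (auto simp: nth_append)
  moreover have "d_total mu = (\<Sum>j<length mu. d (mu ! j))"
    by (simp add: d_total_def sum_list_sum_nth atLeast0LessThan)
  ultimately show ?thesis by (simp add: D_seq_def)
qed

lemma length_D_seq [simp]: "length (D_seq mu) = length mu"
  by (simp add: D_seq_def)

lemma quot_part_snoc:
  "quot_part (mu @ [l]) x = quot_part mu x @ (if l mod 4 = x then [l div 4] else [])"
  by (simp add: quot_part_def select_append) (simp add: select_def)

lemma D_part_snoc:
  "D_part (mu @ [l]) x = D_part mu x @ (if l mod 4 = x then [d_total mu] else [])"
  by (simp add: D_part_def D_seq_snoc select_append) (simp add: select_def)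

lemma length_D_part: "length (D_part mu x) = length (quot_part mu x)"
  by (induction mu rule: rev_induct)
    (auto simp: quot_part_snoc D_part_snoc, simp add: D_part_def quot_part_def select_def D_seq_def)

lemma one_of_each_pair_append:
  "even (length xs) \<Longrightarrow> one_of_each_pair (xs @ ys) = one_of_each_pair xs @ one_of_each_pair ys"
  by (induction xs rule: one_of_each_pair.induct) auto

lemma length_one_of_each_pair: "length (one_of_each_pair xs) = length xs div 2"
  by (induction xs rule: one_of_each_pair.induct) auto

text \<open>
  Keeping one entry of each pair is compatible with appending a further pair only because the
  sequences selected so far have even length.
\<close>

lemma even_length_quot_part:
  assumes "even_paired mu" and "even x"
  shows "even (length (quot_part mu x))"
  using assms
proof (induction rule: even_paired.induct)
  case empty
  then show ?case by (simp add: quot_part_def select_def)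
next
  case (odd_part mu l)
  then have "l mod 4 \<noteq> x" by presburger
  with odd_part show ?case by (simp add: quot_part_snoc)
next
  case (even_pair mu l)
  then show ?case
    using quot_part_snoc[of "mu @ [l]" l x] by (simp add: quot_part_snoc)
qed

definition A_side :: "int list \<Rightarrow> int multiset" where
  "A_side lam =
     mset (one_of_each_pair (quot_part lam 0) \<ominus> one_of_each_pair (D_part lam 0))
     + mset (quot_part lam 1 \<ominus> D_part lam 1)
     + mset (seq_inc (one_of_each_pair (quot_part lam 2)) \<ominus> one_of_each_pair (D_part lam 2))"

definition B_side :: "int list \<Rightarrow> int multiset" where
  "B_side lam =
     mset (one_of_each_pair (quot_part lam 0) \<oplus> one_of_each_pair (D_part lam 0))
     + mset (quot_part lam 3 \<oplus> D_part lam 3)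
     + mset (one_of_each_pair (quot_part lam 2) \<oplus> one_of_each_pair (D_part lam 2))"

lemma sides_Nil: "A_side [] = {#}" "B_side [] = {#}"
  by (simp_all add: A_side_def B_side_def quot_part_def D_part_def select_def)

lemma sides_snoc_1:
  assumes "l mod 4 = 1"
  shows "A_side (mu @ [l]) = add_mset (l div 4 - d_total mu) (A_side mu)"
    and "B_side (mu @ [l]) = B_side mu"
  using assms by (simp_all add: A_side_def B_side_def quot_part_snoc D_part_snoc length_D_part)

lemma sides_snoc_3:
  assumes "l mod 4 = 3"
  shows "A_side (mu @ [l]) = A_side mu"
    and "B_side (mu @ [l]) = add_mset (l div 4 + d_total mu) (B_side mu)"
  using assms by (simp_all add: A_side_def B_side_def quot_part_snoc D_part_snoc length_D_part)

text \<open>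
  Both entries of the appended pair carry the same value of $D$, since even parts have $d = 0$.
\<close>

lemma sides_append_even_pair:
  assumes "even_paired mu" and "even l"
  shows "A_side (mu @ [l, l]) = add_mset ((l + 2) div 4 - d_total mu) (A_side mu)"
    and "B_side (mu @ [l, l]) = add_mset (l div 4 + d_total mu) (B_side mu)"
proof -
  have q: "quot_part (mu @ [l, l]) x
      = quot_part mu x @ (if l mod 4 = x then [l div 4, l div 4] else [])" for x
    using quot_part_snoc[of "mu @ [l]" l x] by (simp add: quot_part_snoc)
  have D: "D_part (mu @ [l, l]) x
      = D_part mu x @ (if l mod 4 = x then [d_total mu, d_total mu] else [])" for x
    using D_part_snoc[of "mu @ [l]" l x] assms(2) by (simp add: D_part_snoc d_def)
  note len = even_length_quot_part[OF assms(1)] length_D_part length_one_of_each_pair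
  have "l mod 4 = 0 \<and> (l + 2) div 4 = l div 4 \<or> l mod 4 = 2 \<and> (l + 2) div 4 = l div 4 + 1"
    using assms(2) by presburger
  then consider "l mod 4 = 0" "(l + 2) div 4 = l div 4"
    | "l mod 4 = 2" "(l + 2) div 4 = l div 4 + 1"
    by blast
  then show "A_side (mu @ [l, l]) = add_mset ((l + 2) div 4 - d_total mu) (A_side mu)"
    and "B_side (mu @ [l, l]) = add_mset (l div 4 + d_total mu) (B_side mu)"
    by (cases; simp add: A_side_def B_side_def q D len one_of_each_pair_append)+
qed

definition formula_bipartition :: "int list \<Rightarrow> int multiset \<times> int multiset" where
  "formula_bipartition lam =
     (if d_total lam > 0 then (drop_zeros (A_side lam), drop_zeros (B_side lam))
      else (drop_zeros (B_side lam), drop_zeros (A_side lam)))"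

text \<open>
  Appending an odd part moves $d$ by one. The recursion swaps the components precisely when this
  carries $d$ across the boundary between $0$ and $1$, which is where the formula exchanges the
  roles of the two sides.
\<close>

lemma bipartition_odd_step:
  assumes "rho mu = formula_bipartition mu" and "odd l"
  shows "rho (mu @ [l]) = formula_bipartition (mu @ [l])"
proof -
  have "l mod 4 = 1 \<and> (l - 1) div 4 = l div 4 \<or> l mod 4 = 3 \<and> (l - 3) div 4 = l div 4"
    using assms(2) by presburger
  then consider "l mod 4 = 1" "d l = 1" "(l - 1) div 4 = l div 4"
    | "l mod 4 = 3" "d l = -1" "(l - 3) div 4 = l div 4"
    using assms(2) by (auto simp: d_def)
  then show ?thesis
    using assms
    by cases (auto simp: rho.simps[of "mu @ [l]"] formula_bipartition_def Let_def
        sides_snoc_1 sides_snoc_3)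
qed

text \<open>
  Appending a pair of even parts leaves $d$ unchanged, so each side stays in its component.
\<close>

lemma bipartition_even_step:
  assumes "rho mu = formula_bipartition mu" and "even_paired mu" and "even l"
  shows "rho (mu @ [l, l]) = formula_bipartition (mu @ [l, l])"
proof -
  have "d l = 0" using assms(3) by (simp add: d_def)
  then show ?thesis
    using assms
    by (simp add: rho.simps[of "mu @ [l, l]"] formula_bipartition_def Let_def butlast_append
        sides_append_even_pair)
qed

lemma rho_eq_formula_bipartition:
  "even_paired lam \<Longrightarrow> rho lam = formula_bipartition lam"
proof (induction rule: even_paired.induct)
  case empty
  then show ?case by (simp add: rho.simps formula_bipartition_def sides_Nil)
qed (simp_all add: bipartition_odd_step bipartition_even_step)

theorem proposition5p4p1:
  fixes lam :: "int list"
  assumes "is_partition lam" and "rather_odd lam"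
  shows "rho lam =
    (let L0 = one_of_each_pair (quot_part lam 0);
         L1 = quot_part lam 1;
         L2 = one_of_each_pair (quot_part lam 2);
         L3 = quot_part lam 3;
         D0 = one_of_each_pair (D_part lam 0);
         D1 = D_part lam 1;
         D2 = one_of_each_pair (D_part lam 2);
         D3 = D_part lam 3;
         A = drop_zeros (mset (L0 \<ominus> D0) + mset (L1 \<ominus> D1) + mset (seq_inc L2 \<ominus> D2));
         B = drop_zeros (mset (L0 \<oplus> D0) + mset (L3 \<oplus> D3) + mset (L2 \<oplus> D2))
     in if d_total lam > 0 then (A, B) else (B, A))"
proof -
  have "even_paired lam"
    using assms even_paired_if_sorted unfolding is_partition_def rather_odd_def by blast
  then show ?thesis
    unfolding Let_def A_side_def[symmetric] B_side_def[symmetric]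
    by (simp add: rho_eq_formula_bipartition formula_bipartition_def)
qed

end
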